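(* Let $\mathcal{M}$ be a Markov decision process with state set $S$ and initial state $\hat{s}$, let $\varepsilon > 0$, let $C_0 \subseteq S$ with $\hat{s} \in C_0$, and let $U_0 : S \to [0,1]$ be consistent with $C_0$, i.e. $U_0(s) \geq \Pr^{\max}_{\mathcal{M},s}[\Diamond \overline{C_0}]$ for all $s \in S$. Consider the algorithm LearnCore run on $\mathcal{M}$, $\varepsilon$, $U_0$, $C_0$ with a path-sampling procedure SamplePath. If SamplePath is fair, then LearnCore terminates, and if SamplePath is almost surely fair, then LearnCore terminates almost surely. Moreover, LearnCore is correct: whenever it terminates, the returned set $C$ is an $\varepsilon$-core of $\mathcal{M}$.
   Context: A Markov decision process (MDP) is a tuple $\mathcal{M} = (S, \hat{s}, Act, Av, \Delta)$ where $S$ is a finite set of states, $\hat{s} \in S$ is the initial state, $Act$ is a finite set of actions, $Av : S \to 2^{Act} \setminus \{\emptyset\}$ assigns to each state a non-empty set of available actions (w.l.o.g. $Av(s) \cap Av(s') = \emptyset$ for $s \neq s'$), and $\Delta$ assigns to each state $s$ and $a \in Av(s)$ a probability distribution $\Delta(s,a)$ on $S$; write $\Delta(s,a,s')$ for $\Delta(s,a)(s')$. A strategy $\pi$ maps each finite path $s_0 a_0 s_1 a_1 \dots s_n$ to a probability distribution on $Av(s_n)$. Together with a start state $s$ it induces a probability measure $\Pr^{\pi}_{\mathcal{M},s}$ on infinite paths, and $\Pr^{\max}_{\mathcal{M},s}[A] = \sup_\pi \Pr^{\pi}_{\mathcal{M},s}[A]$. For $T \subseteq S$, $\Diamond T$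 is the set of infinite paths visiting $T$ at least once (the starting state counts), and $\overline{T} = S \setminus T$. A set $C \subseteq S$ is an $\varepsilon$-core if $\Pr^{\max}_{\mathcal{M},\hat{s}}[\Diamond \overline{C}] < \varepsilon$. An end component is a pair $(T,B)$ with $\emptyset \neq T \subseteq S$ and $\emptyset \neq B \subseteq \bigcup_{s\in T} Av(s)$ such that (i) $\operatorname{supp} \Delta(s,a) \subseteq T$ for all $s \in T$, $a \in B \cap Av(s)$, and (ii) for all $s,s' \in T$ there is a finite path from $s$ to $s'$ staying in $T$ and using only actions of $B$. Algorithm LearnCore. The state of the algorithm is a set $C \subseteq S$ (the explored states) and a function $U : S \to [0,1]$, initialized with $C_0$ and $U_0$. While $U(\hat{s}) \geq \varepsilon$, do the following: 1. obtain a finite path $\varrho$ of $\mathcal{M}$ from SamplePath (which may be randomized and may depend on the current $U$ and the history; paths need not start in $\hat{s}$); 2. add all states of $\varrho$ to $C$; 3. (UpdateECs) for each end component $(T,B)$ of $\mathcal{M}$ with $T \subseteq C$ that is maximal (w.r.t. componentwise inclusion) among those, lower $U(s)$, for all $s \in T$, to the maximum of $\sum_{s' \in S} \Delta(t,a,s') \cdot U(s')$ over all $t \in T$ and $a \in Av(t)\setminus B$ (actions leaving the component), this maximum being $0$ if there is no such action; i.e. $U(s)$ becomes the minimum of its current value and this maximum; 4. for each state $s$ in $\varrho$, set $U(s) \leftarrow \min\{U(s), \max_{a \in Av(s)} \sum_{s' \in S} \Delta(s,a,s') \cdot U(s')\}$. When the loop ends, return $C$. A state is partially explored if it is not in the current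 $C$ but is a successor (under some available action, with positive probability) of a state in $C$. SamplePath is fair if, should the loop run forever, (i) every partially explored state is eventually contained in a sampled path and (ii) every explored state $s$ with $U(s) > 0$ (persistently) is contained in infinitely many sampled paths. It is almost surely fair if this holds with probability $1$. *)

theory Defs
  imports "HOL-Probability.Probability"
begin

section \<open>Markov decision processes\<close>

text \<open>
  The finite sets of states and of actions are the types \<open>'s\<close> and \<open>'a\<close> of class \<open>finite\<close>.
  The distribution \<^term>\<open>delta M s a\<close> is meaningful only for actions available in \<open>s\<close>.
\<close>

record ('s, 'a) mdp =
  init :: 's
  avail :: "'s \<Rightarrow> 'a set"
  delta :: "'s \<Rightarrow> 'a \<Rightarrow> 's pmf"

definition is_mdp :: "('s::finite, 'a::finite) mdp \<Rightarrow> bool" where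
  "is_mdp M \<longleftrightarrow> (\<forall>s. avail M s \<noteq> {}) \<and> (\<forall>s s'. s \<noteq> s' \<longrightarrow> avail M s \<inter> avail M s' = {})"

text \<open>
  The finite path \<open>s\<^sub>0 a\<^sub>0 s\<^sub>1 a\<^sub>1 \<dots> s\<^sub>n\<close> is the pair of the list
  \<open>[(s\<^sub>0, a\<^sub>0), \<dots>, (s\<^sub>n\<^sub>-\<^sub>1, a\<^sub>n\<^sub>-\<^sub>1)]\<close> and the final state \<open>s\<^sub>n\<close>.
\<close>

type_synonym ('s, 'a) fpath = "('s \<times> 'a) list \<times> 's"

fun first_state :: "('s, 'a) fpath \<Rightarrow> 's" where
  "first_state ([], s) = s"
| "first_state ((t, a) # h, s) = t"

fun finite_path :: "('s, 'a) mdp \<Rightarrow> ('s, 'a) fpath \<Rightarrow> bool" where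
  "finite_path M ([], s) = True"
| "finite_path M ((t, a) # h, s) \<longleftrightarrow>
     a \<in> avail M t \<and> first_state (h, s) \<in> set_pmf (delta M t a) \<and> finite_path M (h, s)"

definition path_states :: "('s, 'a) fpath \<Rightarrow> 's set" where
  "path_states \<rho> = insert (snd \<rho>) (fst ` set (fst \<rho>))"

definition path_actions :: "('s, 'a) fpath \<Rightarrow> 'a set" where
  "path_actions \<rho> = snd ` set (fst \<rho>)"

section \<open>Strategies and the induced measure on infinite paths\<close>

type_synonym ('s, 'a) strategy = "('s, 'a) fpath \<Rightarrow> 'a pmf"

definition is_strategy :: "('s, 'a) mdp \<Rightarrow> ('s, 'a) strategy \<Rightarrow> bool" where
  "is_strategy M \<pi> \<longleftrightarrow> (\<forall>\<rho>. finite_path M \<rho> \<longrightarrow> set_pmf (\<pi> \<rho>) \<subseteq> avail M (snd \<rho>))"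

text \<open>
  Infinite paths are functions \<open>\<omega>\<close> with \<open>\<omega> i = (s\<^sub>i, a\<^sub>i)\<close>. The kernel gives the law of
  \<open>(s\<^sub>n, a\<^sub>n)\<close> conditioned on \<open>(s\<^sub>i, a\<^sub>i)\<close> for \<open>i < n\<close>.
\<close>

fun path_kernel ::
  "('s, 'a) mdp \<Rightarrow> ('s, 'a) strategy \<Rightarrow> 's \<Rightarrow> nat \<Rightarrow> (nat \<Rightarrow> 's \<times> 'a) \<Rightarrow> ('s \<times> 'a) pmf" where
  "path_kernel M \<pi> s 0 \<omega> = map_pmf (Pair s) (\<pi> ([], s))"
| "path_kernel M \<pi> s (Suc n) \<omega> =
     bind_pmf (delta M (fst (\<omega> n)) (snd (\<omega> n)))
       (\<lambda>s'. map_pmf (Pair s') (\<pi> (map \<omega> [0..<Suc n], s')))"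

abbreviation path_kernel_measure ::
  "('s, 'a) mdp \<Rightarrow> ('s, 'a) strategy \<Rightarrow> 's \<Rightarrow> nat \<Rightarrow> (nat \<Rightarrow> 's \<times> 'a) \<Rightarrow> ('s \<times> 'a) measure" where
  "path_kernel_measure M \<pi> s n \<omega> \<equiv> measure_pmf (path_kernel M \<pi> s n \<omega>)"

definition path_measure ::
  "('s, 'a) mdp \<Rightarrow> ('s, 'a) strategy \<Rightarrow> 's \<Rightarrow> (nat \<Rightarrow> 's \<times> 'a) measure" where
  "path_measure M \<pi> s =
     projective_family.lim UNIV
       (Ionescu_Tulcea.CI (path_kernel_measure M \<pi> s) (\<lambda>_. count_space UNIV))
       (\<lambda>_. count_space UNIV)"

lemma Ionescu_Tulcea_path_kernel:
  fixes M :: "('s::finite, 'a::finite) mdp"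
  shows "Ionescu_Tulcea (path_kernel_measure M \<pi> s) (\<lambda>_. count_space UNIV)"
proof
  show "path_kernel_measure M \<pi> s n
      \<in> (\<Pi>\<^sub>M i\<in>{0..<n}. count_space UNIV) \<rightarrow>\<^sub>M subprob_algebra (count_space UNIV)" for n
    by (subst measurable_cong_sets[OF _ refl, OF arg_cong[of _ _ sets, OF count_space_PiM_finite]])
      (auto simp: space_subprob_algebra
        intro: prob_space_imp_subprob_space measure_pmf.prob_space_axioms)
qed

lemma sets_path_measure:
  fixes M :: "('s::finite, 'a::finite) mdp"
  shows "sets (path_measure M \<pi> s) = sets (\<Pi>\<^sub>M i\<in>UNIV. count_space UNIV)"
proof -
  interpret IT: Ionescu_Tulcea "path_kernel_measure M \<pi> s" "\<lambda>_. count_space UNIV"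
    by (rule Ionescu_Tulcea_path_kernel)
  show ?thesis
    unfolding path_measure_def by simp
qed

lemma path_kernel_cong:
  "(\<And>i. i < n \<Longrightarrow> \<omega> i = \<omega>' i) \<Longrightarrow> path_kernel M \<pi> s n \<omega> = path_kernel M \<pi> s n \<omega>'"
proof (cases n)
  case (Suc m)
  moreover assume "\<And>i. i < n \<Longrightarrow> \<omega> i = \<omega>' i"
  ultimately have "map \<omega> [0..<Suc m] = map \<omega>' [0..<Suc m]" "\<omega> m = \<omega>' m"
    by auto
  then show ?thesis
    by (simp only: Suc path_kernel.simps)
qed simp

lemma emeasure_path_measure_cylinder:
  fixes M :: "('s::finite, 'a::finite) mdp"
  shows "emeasure (path_measure M \<pi> s) {\<omega>. \<forall>i<n. \<omega> i = x i} =
    (\<Prod>i<n. ennreal (pmf (path_kernel M \<pi> s i x) (x i)))"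
proof -
  let ?N = "\<lambda>_::nat. count_space (UNIV :: ('s \<times> 'a) set)"
  interpret IT: Ionescu_Tulcea "path_kernel_measure M \<pi> s" ?N
    by (rule Ionescu_Tulcea_path_kernel)
  let ?x = "\<lambda>n. restrict x {0..<n}"
  have PiM: "Pi\<^sub>M {0..<n} ?N = count_space (PiE {0..<n} (\<lambda>_. UNIV))" for n
    by (rule count_space_PiM_finite) auto
  have C: "emeasure (IT.C 0 n (\<lambda>_. undefined)) {?x n} =
    (\<Prod>i<n. ennreal (pmf (path_kernel M \<pi> s i x) (x i)))" for n
  proof (induction n)
    case 0
    have "(\<lambda>_. undefined) \<in> space (Pi\<^sub>M {0..<0} ?N)"
      by (simp add: space_PiM)
    then show ?case
      by (simp add: restrict_def PiM_empty)
  next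
    case (Suc n)
    have u: "(\<lambda>_. undefined) \<in> space (Pi\<^sub>M {0..<0} ?N)"
      by (simp add: space_PiM)
    have eP: "emeasure (IT.eP n \<omega>) {?x (Suc n)} =
        ennreal (pmf (path_kernel M \<pi> s n x) (x n)) * indicator {?x n} \<omega>"
      if "\<omega> \<in> space (Pi\<^sub>M {0..<n} ?N)" for \<omega>
    proof -
      have ext: "\<omega> \<in> extensional {0..<n}"
        using that by (auto simp: space_PiM PiE_def)
      have "(fun_upd \<omega> n y = ?x (Suc n)) \<longleftrightarrow> \<omega> = ?x n \<and> y = x n" for y
        using ext unfolding fun_eq_iff extensional_def restrict_def
        by (auto simp: less_Suc_eq)
      then have "(\<lambda>y. fun_upd \<omega> n y) -` {?x (Suc n)} = (if \<omega> = ?x n then {x n} else {})"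
        unfolding vimage_def by (simp del: restrict_fupd)
      moreover have "path_kernel M \<pi> s n (?x n) = path_kernel M \<pi> s n x"
        by (rule path_kernel_cong) simp
      ultimately show ?thesis
        using that by (subst IT.emeasure_eP) (auto simp: PiM emeasure_pmf_single)
    qed
    have "emeasure (IT.C 0 (Suc n) (\<lambda>_. undefined)) {?x (Suc n)} =
      (\<integral>\<^sup>+\<omega>. emeasure (IT.eP n \<omega>) {?x (Suc n)} \<partial>IT.C 0 n (\<lambda>_. undefined))"
      using IT.prob_space_C[OF u, THEN prob_space.not_empty, of n] IT.measurable_eP[of n]
      by (subst IT.C.simps, subst emeasure_bind[where N="Pi\<^sub>M {0..<Suc n} ?N"])
        (auto simp: IT.space_C[OF u] PiM measurable_cong_sets[OF IT.sets_C[OF u] refl])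
    also have "\<dots> = (\<integral>\<^sup>+\<omega>. ennreal (pmf (path_kernel M \<pi> s n x) (x n)) *
        indicator {?x n} \<omega> \<partial>IT.C 0 n (\<lambda>_. undefined))"
      by (intro nn_integral_cong eP) (simp add: IT.space_C[OF u])
    also have "\<dots> = ennreal (pmf (path_kernel M \<pi> s n x) (x n)) *
        emeasure (IT.C 0 n (\<lambda>_. undefined)) {?x n}"
      by (rule nn_integral_cmult_indicator) (simp add: IT.sets_C[OF u] PiM)
    finally show ?case
      by (simp only: Suc.IH prod.lessThan_Suc mult.commute)
  qed
  have "emeasure (path_measure M \<pi> s) (prod_emb UNIV ?N {0..<n} {?x n}) =
    emeasure (IT.CI {0..<n}) {?x n}"
    unfolding path_measure_def by (rule IT.lim) (auto simp: PiM)
  also have "\<dots> = emeasure (IT.C 0 n (\<lambda>_. undefined)) (prod_emb {0..<n} ?N {0..<n} {?x n})"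
    by (rule IT.emeasure_CI) (auto simp: PiM)
  also have "prod_emb {0..<n} ?N {0..<n} {?x n} = {?x n}"
    by (rule prod_emb_id) auto
  also have "prod_emb UNIV ?N {0..<n} {?x n} = {\<omega>. \<forall>i<n. \<omega> i = x i}"
    by (auto simp: prod_emb_def fun_eq_iff restrict_def) metis
  finally show ?thesis
    by (simp only: C)
qed

lemma prob_space_path_measure:
  fixes M :: "('s::finite, 'a::finite) mdp"
  shows "prob_space (path_measure M \<pi> s)"
proof
  have "space (path_measure M \<pi> s) = UNIV"
    using sets_eq_imp_space_eq[OF sets_path_measure[of M \<pi> s]] by (simp add: space_PiM)
  then show "emeasure (path_measure M \<pi> s) (space (path_measure M \<pi> s)) = 1"
    using emeasure_path_measure_cylinder[of M \<pi> s 0] by simp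
qed

definition reach :: "'s set \<Rightarrow> (nat \<Rightarrow> 's \<times> 'a) set" where
  "reach T = {\<omega>. \<exists>i. fst (\<omega> i) \<in> T}"

definition pr_max :: "('s, 'a) mdp \<Rightarrow> 's \<Rightarrow> (nat \<Rightarrow> 's \<times> 'a) set \<Rightarrow> real" where
  "pr_max M s A = (SUP \<pi>\<in>{\<pi>. is_strategy M \<pi>}. measure (path_measure M \<pi> s) A)"

definition is_core :: "('s, 'a) mdp \<Rightarrow> real \<Rightarrow> 's set \<Rightarrow> bool" where
  "is_core M \<epsilon> C \<longleftrightarrow> pr_max M (init M) (reach (- C)) < \<epsilon>"

section \<open>End components\<close>

definition end_component :: "('s, 'a) mdp \<Rightarrow> 's set \<times> 'a set \<Rightarrow> bool" where
  "end_component M = (\<lambda>(T, B).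
     T \<noteq> {} \<and> B \<noteq> {} \<and> B \<subseteq> (\<Union>s\<in>T. avail M s) \<and>
     (\<forall>s\<in>T. \<forall>a\<in>B \<inter> avail M s. set_pmf (delta M s a) \<subseteq> T) \<and>
     (\<forall>s\<in>T. \<forall>s'\<in>T. \<exists>\<rho>. finite_path M \<rho> \<and> first_state \<rho> = s \<and> snd \<rho> = s' \<and>
        path_states \<rho> \<subseteq> T \<and> path_actions \<rho> \<subseteq> B))"

definition max_end_components :: "('s, 'a) mdp \<Rightarrow> 's set \<Rightarrow> ('s set \<times> 'a set) set" where
  "max_end_components M C = {(T, B). end_component M (T, B) \<and> T \<subseteq> C \<and>
     (\<forall>T' B'. end_component M (T', B') \<and> T' \<subseteq> C \<and> T \<subseteq> T' \<and> B \<subseteq> B' \<longrightarrow> T' = T \<and> B' = B)}"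

section \<open>The algorithm\<close>

definition step_value :: "('s::finite, 'a) mdp \<Rightarrow> ('s \<Rightarrow> real) \<Rightarrow> 's \<Rightarrow> 'a \<Rightarrow> real" where
  "step_value M U s a = (\<Sum>s'\<in>UNIV. pmf (delta M s a) s' * U s')"

definition leave_value ::
  "('s::finite, 'a::finite) mdp \<Rightarrow> ('s \<Rightarrow> real) \<Rightarrow> 's set \<times> 'a set \<Rightarrow> real" where
  "leave_value M U = (\<lambda>(T, B).
     let V = {step_value M U t a | t a. t \<in> T \<and> a \<in> avail M t - B}
     in if V = {} then 0 else Max V)"

definition update_ec ::
  "('s::finite, 'a::finite) mdp \<Rightarrow> 's set \<times> 'a set \<Rightarrow> ('s \<Rightarrow> real) \<Rightarrow> ('s \<Rightarrow> real)" where
  "update_ec M E U = (\<lambda>s. if s \<in> fst E then min (U s) (leave_value M U E) else U s)"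

definition update_state ::
  "('s::finite, 'a::finite) mdp \<Rightarrow> 's \<Rightarrow> ('s \<Rightarrow> real) \<Rightarrow> ('s \<Rightarrow> real)" where
  "update_state M s U =
     (\<lambda>t. if t = s then min (U s) (Max (step_value M U s ` avail M s)) else U t)"

type_synonym 's config = "'s set \<times> ('s \<Rightarrow> real)"

text \<open>
  The loops over end components and over the states of the sampled path update \<open>U\<close> in place, one
  after the other, in an order that is left unspecified. A state may be updated repeatedly, as
  it may occur several times on the path.
\<close>

definition learn_step ::
  "('s::finite, 'a::finite) mdp \<Rightarrow> ('s, 'a) fpath \<Rightarrow> 's config \<Rightarrow> 's config \<Rightarrow> bool" where
  "learn_step M \<rho> = (\<lambda>(C, U) (C', U').
     C' = C \<union> path_states \<rho> \<and>
     (\<exists>Es ss. distinct Es \<and> set Es = max_end_components M C' \<and> set ss = path_states \<rho> \<and>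
        U' = fold (update_state M) ss (fold (update_ec M) Es U)))"

definition halted :: "('s, 'a) mdp \<Rightarrow> real \<Rightarrow> 's config \<Rightarrow> bool" where
  "halted M \<epsilon> = (\<lambda>(C, U). \<not> U (init M) \<ge> \<epsilon>)"

text \<open>
  A path sampler maps the history (the configurations and sampled paths of all previous
  iterations), the current configuration and the random seed \<open>\<omega>\<close>, drawn once from \<open>\<Omega>\<close>, to a
  path. The seed may encode fresh randomness for every call as well as a random internal state; a
  deterministic sampler is one that ignores it.
\<close>

type_synonym ('s, 'a, 'w) sampler =
  "('s config \<times> ('s, 'a) fpath) list \<Rightarrow> 's config \<Rightarrow> 'w \<Rightarrow> ('s, 'a) fpath"

definition path_sampler ::
  "('s, 'a) mdp \<Rightarrow> 'w measure \<Rightarrow> ('s, 'a, 'w) sampler \<Rightarrow> bool" where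
  "path_sampler M \<Omega> smp \<longleftrightarrow> prob_space \<Omega> \<and>
     (\<forall>h x. smp h x \<in> measurable \<Omega> (count_space UNIV)) \<and>
     (\<forall>h x. \<forall>\<omega>\<in>space \<Omega>. finite_path M (smp h x \<omega>))"

text \<open>
  In a run, \<open>c n\<close> is the configuration before iteration \<open>n\<close> and \<open>\<rho> n\<close> the path sampled in it.
  After the loop has ended the configuration stays constant and \<open>\<rho> n\<close> has no meaning.
\<close>

definition learn_core_run ::
  "('s::finite, 'a::finite) mdp \<Rightarrow> real \<Rightarrow> 's set \<Rightarrow> ('s \<Rightarrow> real) \<Rightarrow> ('s, 'a, 'w) sampler \<Rightarrow> 'w \<Rightarrow>
   (nat \<Rightarrow> 's config) \<Rightarrow> (nat \<Rightarrow> ('s, 'a) fpath) \<Rightarrow> bool" where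
  "learn_core_run M \<epsilon> C\<^sub>0 U\<^sub>0 smp \<omega> c \<rho> \<longleftrightarrow> c 0 = (C\<^sub>0, U\<^sub>0) \<and>
     (\<forall>n. if halted M \<epsilon> (c n) then c (Suc n) = c n
          else \<rho> n = smp (map (\<lambda>k. (c k, \<rho> k)) [0..<n]) (c n) \<omega> \<and>
               learn_step M (\<rho> n) (c n) (c (Suc n)))"

definition terminates :: "('s, 'a) mdp \<Rightarrow> real \<Rightarrow> (nat \<Rightarrow> 's config) \<Rightarrow> bool" where
  "terminates M \<epsilon> c \<longleftrightarrow> (\<exists>n. halted M \<epsilon> (c n))"

definition partially_explored :: "('s, 'a) mdp \<Rightarrow> 's set \<Rightarrow> 's \<Rightarrow> bool" where
  "partially_explored M C s \<longleftrightarrow>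
     s \<notin> C \<and> (\<exists>t\<in>C. \<exists>a\<in>avail M t. s \<in> set_pmf (delta M t a))"

definition fair_run ::
  "('s, 'a) mdp \<Rightarrow> real \<Rightarrow> (nat \<Rightarrow> 's config) \<Rightarrow> (nat \<Rightarrow> ('s, 'a) fpath) \<Rightarrow> bool" where
  "fair_run M \<epsilon> c \<rho> \<longleftrightarrow> (\<not> terminates M \<epsilon> c \<longrightarrow>
     (\<forall>n s. partially_explored M (fst (c n)) s \<longrightarrow> (\<exists>m\<ge>n. s \<in> path_states (\<rho> m))) \<and>
     (\<forall>n s. s \<in> fst (c n) \<and> (\<forall>m\<ge>n. snd (c m) s > 0) \<longrightarrow> (\<exists>\<^sub>\<infinity>m. s \<in> path_states (\<rho> m))))"

end

theory Submission
  imports Defs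
begin

text \<open>
  Correctness: \<open>U\<close> always dominates the maximal probability of leaving the current \<open>C\<close>, since that
  probability itself satisfies the inequalities imposed by both updates.

  Termination: along a fair run that does not halt, \<open>U\<close> decreases to a limit \<open>L\<close>, and \<open>C\<close> becomes
  constant and closed under successors. Suppose that the maximum \<open>u\<close> of \<open>L\<close> on \<open>C\<close> is positive, and
  let \<open>D\<close> be the set where it is attained. The state updates give every state of \<open>D\<close> an action
  that stays in \<open>D\<close>, and the end component updates give every maximal end component meeting \<open>D\<close> a
  leaving action all of whose successors are in \<open>D\<close>. Together this is impossible: following such
  actions from one component to the next must close a cycle, which contradicts maximality. So \<open>L\<close>
  vanishes on \<open>C\<close>, and \<open>U\<close> eventually drops below \<open>\<epsilon>\<close> at the initial state.
\<close>

section \<open>Reachability within a bounded number of steps\<close>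

text \<open>The probability of the cylinder of paths extending \<open>xs\<close>. The function
  \<open>nth xs\<close> can stand in for an infinite path because the kernel at index
  \<open>i\<close> only reads positions below \<open>i\<close>, all of which lie inside the
  list.\<close>

definition path_prob :: "('s::finite, 'a::finite) mdp \<Rightarrow> ('s, 'a) strategy \<Rightarrow> 's \<Rightarrow> ('s \<times> 'a) list \<Rightarrow> real"
  where "path_prob M \<pi> s xs = (\<Prod>i<length xs. pmf (path_kernel M \<pi> s i (nth xs)) (xs ! i))"

definition reach_within :: "nat \<Rightarrow> 's set \<Rightarrow> (nat \<Rightarrow> 's \<times> 'a) set" where
  "reach_within n T = {\<omega>. \<exists>i<n. fst (\<omega> i) \<in> T}"

text \<open>
  The default distribution makes this a strategy also on paths that do not start in a successor;
  \<^const>\<open>is_strategy\<close> constrains these as well.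
\<close>

definition residual :: "('s::finite, 'a::finite) mdp \<Rightarrow> ('s, 'a) strategy \<Rightarrow> 's \<Rightarrow> 'a \<Rightarrow> ('s, 'a) strategy"
  where "residual M \<pi> s a = (\<lambda>\<rho>. if first_state \<rho> \<in> set_pmf (delta M s a)
    then \<pi> ((s, a) # fst \<rho>, snd \<rho>) else pmf_of_set (avail M (snd \<rho>)))"

lemma space_path_measure:
  fixes M :: "('s::finite, 'a::finite) mdp"
  shows "space (path_measure M \<pi> s) = UNIV"
  using sets_eq_imp_space_eq[OF sets_path_measure[of M \<pi> s]] by (simp add: space_PiM)

lemma measurable_path_coordinate:
  fixes M :: "('s::finite, 'a::finite) mdp"
  shows "(\<lambda>\<omega>. \<omega> i) \<in> path_measure M \<pi> s \<rightarrow>\<^sub>M count_space UNIV"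
  by (subst measurable_cong_sets[OF sets_path_measure refl])
    (rule measurable_component_singleton, simp)

lemma sets_path_coordinate:
  fixes M :: "('s::finite, 'a::finite) mdp"
  shows "{\<omega>. \<omega> i \<in> A} \<in> sets (path_measure M \<pi> s)"
  using measurable_sets[OF measurable_path_coordinate, of A i M \<pi> s]
  by (simp add: space_path_measure vimage_def)

lemma reach_within_sets [simp]:
  fixes M :: "('s::finite, 'a::finite) mdp"
  shows "reach_within n T \<in> sets (path_measure M \<pi> s)"
proof -
  have "reach_within n T = (\<Union>i<n. {\<omega>. \<omega> i \<in> fst -` T})"
    by (auto simp: reach_within_def)
  also have "\<dots> \<in> sets (path_measure M \<pi> s)"
    by (intro sets.finite_UN sets_path_coordinate) auto
  finally show ?thesis .
qed

lemma reach_eq_Union_reach_within: "reach T = (\<Union>n. reach_within n T)"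
  by (auto simp: reach_def reach_within_def)

lemma reach_sets [simp]:
  fixes M :: "('s::finite, 'a::finite) mdp"
  shows "reach T \<in> sets (path_measure M \<pi> s)"
  unfolding reach_eq_Union_reach_within by (intro sets.countable_UN) auto

lemma cylinder_sets:
  fixes M :: "('s::finite, 'a::finite) mdp"
  shows "{\<omega>. map \<omega> [0..<n] = xs} \<in> sets (path_measure M \<pi> s)"
proof (cases "length xs = n")
  case True
  have "{\<omega> \<in> space (path_measure M \<pi> s). \<forall>i\<in>{..<n}. \<omega> i \<in> {xs ! i}} \<in> sets (path_measure M \<pi> s)"
  proof (rule sets.sets_Collect_finite_All)
    show "{\<omega> \<in> space (path_measure M \<pi> s). \<omega> i \<in> {xs ! i}} \<in> sets (path_measure M \<pi> s)" for i
      using sets_path_coordinate[of i "{xs ! i}" M \<pi> s] by (simp add: space_path_measure)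
  qed simp
  also have "{\<omega> \<in> space (path_measure M \<pi> s). \<forall>i\<in>{..<n}. \<omega> i \<in> {xs ! i}} = {\<omega>. map \<omega> [0..<n] = xs}"
    using True by (auto simp: list_eq_iff_nth_eq space_path_measure)
  finally show ?thesis .
next
  case False
  then have "{\<omega>. map \<omega> [0..<n] = xs} = {}" by auto
  then show ?thesis by (simp only: sets.empty_sets)
qed

lemma measure_cylinder:
  fixes M :: "('s::finite, 'a::finite) mdp"
  assumes "length xs = n"
  shows "measure (path_measure M \<pi> s) {\<omega>. map \<omega> [0..<n] = xs} = path_prob M \<pi> s xs"
proof -
  have "{\<omega>. map \<omega> [0..<n] = xs} = {\<omega>. \<forall>i<n. \<omega> i = xs ! i}"
    using assms by (auto simp: list_eq_iff_nth_eq)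
  then have "emeasure (path_measure M \<pi> s) {\<omega>. map \<omega> [0..<n] = xs} = ennreal (path_prob M \<pi> s xs)"
    using assms by (simp add: emeasure_path_measure_cylinder path_prob_def prod_ennreal)
  then show ?thesis
    by (simp add: measure_def path_prob_def prod_nonneg)
qed

text \<open>The event depends on the first \<open>n\<close> coordinates only, so it is a finite
  disjoint union of cylinders. From here on bounded reachability is handled by finite sums over
  lists.\<close>

lemma measure_reach_within:
  fixes M :: "('s::finite, 'a::finite) mdp"
  shows "measure (path_measure M \<pi> s) (reach_within n T) =
    (\<Sum>xs | length xs = n \<and> (\<exists>x\<in>set xs. fst x \<in> T). path_prob M \<pi> s xs)"
proof -
  interpret prob_space "path_measure M \<pi> s" by (rule prob_space_path_measure)
  let ?L = "{xs. length xs = n \<and> (\<exists>x\<in>set xs. fst x \<in> T)} :: ('s \<times> 'a) list set"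
  let ?cyl = "\<lambda>xs. {\<omega>::nat \<Rightarrow> 's \<times> 'a. map \<omega> [0..<n] = xs}"
  have fin: "finite ?L"
    using finite_lists_length_eq[of "UNIV :: ('s \<times> 'a) set" n] by (rule rev_finite_subset) auto
  have "\<omega> \<in> reach_within n T \<longleftrightarrow> (\<exists>x\<in>set (map \<omega> [0..<n]). fst x \<in> T)" for \<omega> :: "nat \<Rightarrow> 's \<times> 'a"
    by (simp add: reach_within_def atLeast0LessThan Bex_def lessThan_def)
  then have "reach_within n T = \<Union> (?cyl ` ?L)"
    by (simp add: set_eq_iff)
  then have "measure (path_measure M \<pi> s) (reach_within n T) =
      (\<Sum>xs\<in>?L. measure (path_measure M \<pi> s) (?cyl xs))"
    using fin by (auto simp: disjoint_family_on_def cylinder_sets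
        intro!: finite_measure_finite_Union)
  also have "\<dots> = (\<Sum>xs\<in>?L. path_prob M \<pi> s xs)"
    by (intro sum.cong refl measure_cylinder) simp
  finally show ?thesis .
qed

section \<open>First-step decomposition of bounded reachability\<close>

lemma pmf_map_Pair: "pmf (map_pmf (Pair s) p) (t, a) = (if t = s then pmf p a else 0)"
proof (cases "t = s")
  case True
  then show ?thesis
    using pmf_map_inj'[of "Pair s" p a] by (simp add: inj_on_def)
qed (auto simp: pmf_eq_0_set_pmf)

lemma pmf_bind_map_Pair:
  fixes p :: "'s::finite pmf"
  shows "pmf (bind_pmf p (\<lambda>s. map_pmf (Pair s) (f s))) (t, a) = pmf p t * pmf (f t) a"
proof -
  have "pmf (bind_pmf p (\<lambda>s. map_pmf (Pair s) (f s))) (t, a) =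
      (\<Sum>s\<in>UNIV. pmf p s * (if t = s then pmf (f s) a else 0))"
    by (simp add: pmf_bind integral_measure_pmf[of UNIV] pmf_map_Pair)
  also have "\<dots> = pmf p t * pmf (f t) a"
    by (subst sum.remove[of _ t]) (auto intro!: sum.neutral)
  finally show ?thesis .
qed

lemma path_prob_Cons_neq:
  "t \<noteq> s \<Longrightarrow> path_prob M \<pi> s ((t, a) # xs) = 0"
  unfolding path_prob_def length_Cons prod.lessThan_Suc_shift by (simp add: pmf_map_Pair)

text \<open>Dropping the first pair shifts the kernels by one index. The only mismatch is at
  \<open>u\<close>: the original process draws it from \<open>delta M s a\<close>, whereas the
  residual process starts there with certainty, and this accounts for the extra factor.\<close>

lemma path_prob_residual:
  fixes M :: "('s::finite, 'a::finite) mdp"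
  assumes u: "u \<in> set_pmf (delta M s a)"
  shows "path_prob M \<pi> s ((s, a) # (u, b) # zs) =
    pmf (\<pi> ([], s)) a * (pmf (delta M s a) u * path_prob M (residual M \<pi> s a) u ((u, b) # zs))"
proof -
  have *: "residual M \<pi> s a ((u, c) # h, t) = \<pi> ((s, a) # (u, c) # h, t)" for c h t
    using u by (simp add: residual_def)
  \<comment> \<open>Both kernels apply \<open>delta\<close> at the same last pair, and the residual
    strategy prepends \<open>(s, a)\<close> to its history, which restores the history seen by
    \<open>\<pi>\<close>.\<close>
  have "path_kernel M \<pi> s (Suc (Suc i)) (nth ((s, a) # (u, b) # zs)) =
    path_kernel M (residual M \<pi> s a) u (Suc i) (nth ((u, b) # zs))" for i
  proof -
    have m: "map (nth ((u, b) # zs)) [0..<Suc i] = (u, b) # map (nth zs) [0..<i]"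
      by (simp only: map_upt_Suc nth_Cons_0 nth_Cons_Suc)
    have "map (nth ((s, a) # (u, b) # zs)) [0..<Suc (Suc i)] =
        (s, a) # (u, b) # map (nth zs) [0..<i]"
      by (simp only: map_upt_Suc nth_Cons_0 nth_Cons_Suc)
    with m show ?thesis
      by (simp only: path_kernel.simps * nth_Cons_Suc)
  qed
  moreover have "pmf (path_kernel M \<pi> s (Suc 0) (nth ((s, a) # (u, b) # zs))) (u, b) =
    pmf (delta M s a) u * pmf (\<pi> ([(s, a)], u)) b"
    by (simp add: pmf_bind_map_Pair)
  moreover have "pmf (residual M \<pi> s a ([], u)) b = pmf (\<pi> ([(s, a)], u)) b"
    using u by (simp add: residual_def)
  ultimately show ?thesis
    unfolding path_prob_def length_Cons prod.lessThan_Suc_shift o_def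
    by (simp add: pmf_map_Pair del: path_kernel.simps(2))
qed

text \<open>For nonempty \<open>ys\<close> only the summand at its first state survives; for empty
  \<open>ys\<close> the weights add up to 1. The sum form treats both cases alike and later becomes
  a \<open>step_value\<close>.\<close>

lemma path_prob_Cons:
  fixes M :: "('s::finite, 'a::finite) mdp"
  shows "path_prob M \<pi> s ((s, a) # ys) = pmf (\<pi> ([], s)) a *
    (\<Sum>s'\<in>UNIV. pmf (delta M s a) s' * path_prob M (residual M \<pi> s a) s' ys)"
proof (cases ys)
  case Nil
  then show ?thesis
    by (simp add: path_prob_def pmf_map_Pair sum_pmf_eq_1)
next
  case (Cons y zs)
  obtain u b where y: "y = (u, b)" by force
  have "(\<Sum>s'\<in>UNIV. pmf (delta M s a) s' * path_prob M (residual M \<pi> s a) s' ys) =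
      pmf (delta M s a) u * path_prob M (residual M \<pi> s a) u ys"
    by (subst sum.remove[of _ u]) (auto intro!: sum.neutral simp: Cons y path_prob_Cons_neq)
  moreover have "path_prob M \<pi> s ((s, a) # ys) =
      pmf (\<pi> ([], s)) a * (pmf (delta M s a) u * path_prob M (residual M \<pi> s a) u ys)"
  proof (cases "u \<in> set_pmf (delta M s a)")
    case True
    then show ?thesis by (simp add: Cons y path_prob_residual)
  next
    case False
    \<comment> \<open>Here \<open>residual\<close> uses its default distribution, but both sides
      carry the factor 0.\<close>
    then have "pmf (delta M s a) u = 0" by (simp add: set_pmf_iff)
    then show ?thesis
      unfolding Cons y path_prob_def length_Cons prod.lessThan_Suc_shift o_def
      by (simp add: pmf_bind_map_Pair)
  qed
  ultimately show ?thesis by simp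
qed

text \<open>The Bellman equation for a fixed strategy. As \<open>s\<close> is outside
  \<open>T\<close>, the visit has to occur in the remaining \<open>n\<close> positions, which are
  governed by the residual strategy.\<close>

lemma measure_reach_within_Suc:
  fixes M :: "('s::finite, 'a::finite) mdp"
  assumes "s \<notin> T"
  shows "measure (path_measure M \<pi> s) (reach_within (Suc n) T) = (\<Sum>a\<in>UNIV. pmf (\<pi> ([], s)) a *
    step_value M (\<lambda>s'. measure (path_measure M (residual M \<pi> s a) s') (reach_within n T)) s a)"
proof -
  let ?L = "\<lambda>n. {xs. length xs = n \<and> (\<exists>x\<in>set xs. fst x \<in> T)} :: ('s \<times> 'a) list set"
  let ?f = "\<lambda>(a, ys). (s, a) # ys"
  let ?q = "\<lambda>a. path_prob M (residual M \<pi> s a)"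
  have fin: "finite (?L n)" for n
    using finite_lists_length_eq[of "UNIV :: ('s \<times> 'a) set" n] by (rule rev_finite_subset) auto
  have "measure (path_measure M \<pi> s) (reach_within (Suc n) T) = (\<Sum>xs\<in>?L (Suc n). path_prob M \<pi> s xs)"
    by (rule measure_reach_within)
  \<comment> \<open>Only lists that begin in \<open>s\<close> have positive probability, and their
    tails must visit \<open>T\<close>.\<close>
  also have "\<dots> = (\<Sum>xs\<in>?f ` (UNIV \<times> ?L n). path_prob M \<pi> s xs)"
  proof (rule sum.mono_neutral_right[OF fin])
    show "?f ` (UNIV \<times> ?L n) \<subseteq> ?L (Suc n)"
      by auto
    show "\<forall>xs\<in>?L (Suc n) - ?f ` (UNIV \<times> ?L n). path_prob M \<pi> s xs = 0"
    proof
      fix xs assume xs: "xs \<in> ?L (Suc n) - ?f ` (UNIV \<times> ?L n)"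
      then obtain t a ys where ys: "xs = (t, a) # ys" "length ys = n"
        by (cases xs) auto
      have "t \<noteq> s"
        using xs ys assms by (auto simp: image_iff)
      then show "path_prob M \<pi> s xs = 0"
        by (simp add: ys path_prob_Cons_neq)
    qed
  qed
  also have "\<dots> = (\<Sum>a\<in>UNIV. \<Sum>ys\<in>?L n. path_prob M \<pi> s ((s, a) # ys))"
    by (subst sum.reindex) (auto simp: inj_on_def sum.cartesian_product case_prod_beta)
  also have "\<dots> = (\<Sum>a\<in>UNIV. pmf (\<pi> ([], s)) a *
      (\<Sum>s'\<in>UNIV. pmf (delta M s a) s' * (\<Sum>ys\<in>?L n. ?q a s' ys)))"
    unfolding path_prob_Cons sum_distrib_left by (subst (2) sum.swap) (rule refl)
  finally show ?thesis
    by (simp add: measure_reach_within step_value_def)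
qed

lemma reach_within_tendsto:
  fixes M :: "('s::finite, 'a::finite) mdp"
  shows "(\<lambda>n. measure (path_measure M \<pi> s) (reach_within n T)) \<longlonglongrightarrow> measure (path_measure M \<pi> s) (reach T)"
proof -
  interpret prob_space "path_measure M \<pi> s" by (rule prob_space_path_measure)
  have "incseq (\<lambda>n. reach_within n T :: (nat \<Rightarrow> 's \<times> 'a) set)"
    by (rule monoI) (force simp: reach_within_def)
  then show ?thesis
    unfolding reach_eq_Union_reach_within by (intro finite_Lim_measure_incseq) auto
qed

section \<open>Bounds on the maximal reachability probability\<close>

text \<open>Makes the supremum in \<open>pr_max\<close> range over a nonempty set.\<close>

lemma is_strategy_uniform:
  assumes "is_mdp M"
  shows "is_strategy M (\<lambda>\<rho>. pmf_of_set (avail M (snd \<rho>)))"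
  using assms by (simp add: is_strategy_def is_mdp_def set_pmf_of_set)

lemma is_strategy_residual:
  assumes "is_mdp M" "is_strategy M \<pi>" "a \<in> avail M s"
  shows "is_strategy M (residual M \<pi> s a)"
  unfolding is_strategy_def
proof (intro allI impI)
  fix \<rho> :: "('a, 'b) fpath" assume \<rho>: "finite_path M \<rho>"
  show "set_pmf (residual M \<pi> s a \<rho>) \<subseteq> avail M (snd \<rho>)"
  proof (cases "first_state \<rho> \<in> set_pmf (delta M s a)")
    case True
    with \<rho> assms(3) have "finite_path M ((s, a) # fst \<rho>, snd \<rho>)" by simp
    with assms(2) have "set_pmf (\<pi> ((s, a) # fst \<rho>, snd \<rho>)) \<subseteq> avail M (snd \<rho>)"
      unfolding is_strategy_def by fastforce
    with True show ?thesis
      by (simp add: residual_def)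
  qed (use assms(1) in \<open>simp add: residual_def set_pmf_of_set is_mdp_def\<close>)
qed

lemma bdd_above_path_measure:
  fixes M :: "('s::finite, 'a::finite) mdp"
  shows "bdd_above ((\<lambda>\<pi>. measure (path_measure M \<pi> s) A) ` P)"
  by (rule bdd_aboveI[of _ 1]) (auto intro: prob_space.prob_le_1[OF prob_space_path_measure])

lemma measure_le_pr_max:
  fixes M :: "('s::finite, 'a::finite) mdp"
  shows "is_strategy M \<pi> \<Longrightarrow> measure (path_measure M \<pi> s) A \<le> pr_max M s A"
  unfolding pr_max_def by (rule cSUP_upper[OF _ bdd_above_path_measure]) simp

lemma pr_max_least:
  assumes "is_mdp M" "\<And>\<pi>. is_strategy M \<pi> \<Longrightarrow> measure (path_measure M \<pi> s) A \<le> x"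
  shows "pr_max M s A \<le> x"
  unfolding pr_max_def using is_strategy_uniform[OF assms(1)] assms(2) by (intro cSUP_least) auto

lemma pr_max_nonneg:
  assumes "is_mdp M" shows "0 \<le> pr_max M s A"
  using measure_le_pr_max[OF is_strategy_uniform[OF assms], of s A] measure_nonneg order_trans by blast

lemma pr_max_reach_mono:
  assumes "is_mdp M" "T \<subseteq> T'"
  shows "pr_max M s (reach T) \<le> pr_max M s (reach T')"
proof (rule pr_max_least[OF assms(1)])
  fix \<pi> assume \<pi>: "is_strategy M \<pi>"
  interpret prob_space "path_measure M \<pi> s" by (rule prob_space_path_measure)
  have "measure (path_measure M \<pi> s) (reach T) \<le> measure (path_measure M \<pi> s) (reach T')"
    using assms(2) by (intro finite_measure_mono reach_sets) (auto simp: reach_def)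
  with measure_le_pr_max[OF \<pi>] show "measure (path_measure M \<pi> s) (reach T) \<le> pr_max M s (reach T')"
    using order_trans by blast
qed

lemma step_value_mono:
  "(\<And>t. t \<in> set_pmf (delta M s a) \<Longrightarrow> U t \<le> V t) \<Longrightarrow> step_value M U s a \<le> step_value M V s a"
  unfolding step_value_def by (rule sum_mono) (metis mult_left_mono pmf_nonneg mult_zero_left set_pmf_iff order_refl)

lemma step_value_const: "step_value M (\<lambda>_. x) s a = x"
  by (simp add: step_value_def sum_distrib_right[symmetric] sum_pmf_eq_1)

lemma step_value_nonneg: "(\<And>t. 0 \<le> U t) \<Longrightarrow> 0 \<le> step_value M U s a"
  by (simp add: step_value_def sum_nonneg)

text \<open>
  Induction on the number of steps works for end components as well: within them the bound \<open>W\<close>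
  reproduces itself, and so no connectedness is needed.
\<close>

lemma pr_max_reach_le:
  fixes M :: "('s::finite, 'a::finite) mdp"
  assumes M: "is_mdp M" and X: "X \<inter> T = {}" and W: "\<And>s. 0 \<le> W s"
    and step: "\<And>s a. s \<in> X \<Longrightarrow> a \<in> avail M s \<Longrightarrow> step_value M (\<lambda>t. if t \<in> X
      then min (W t) (pr_max M t (reach T)) else pr_max M t (reach T)) s a \<le> W s"
    and s: "s \<in> X"
  shows "pr_max M s (reach T) \<le> W s"
proof -
  let ?V = "\<lambda>t. pr_max M t (reach T)"
  let ?Z = "\<lambda>t. if t \<in> X then min (W t) (?V t) else ?V t"
  have le_V: "measure (path_measure M \<pi> t) (reach_within n T) \<le> ?V t" if "is_strategy M \<pi>" for \<pi> t n
  proof -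
    interpret prob_space "path_measure M \<pi> t" by (rule prob_space_path_measure)
    have "measure (path_measure M \<pi> t) (reach_within n T) \<le> measure (path_measure M \<pi> t) (reach T)"
      by (intro finite_measure_mono reach_sets) (auto simp: reach_def reach_within_def)
    with measure_le_pr_max[OF that] show ?thesis
      using order_trans by blast
  qed
  \<comment> \<open>Successors may lie outside \<open>X\<close>, where only \<open>pr_max\<close> is
    available as a bound. Keeping the minimum inside \<open>X\<close> gives an induction hypothesis
    of exactly the form to which \<open>step\<close> applies; \<open>le_V\<close> supplies the other
    half of the minimum.\<close>
  have le_Z: "measure (path_measure M \<pi> t) (reach_within n T) \<le> ?Z t" if "is_strategy M \<pi>" for \<pi> t n
    using that
  proof (induction n arbitrary: \<pi> t)
    case 0
    then show ?case
      using W pr_max_nonneg[OF M] by (simp add: reach_within_def)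
  next
    case (Suc n)
    show ?case
    proof (cases "t \<in> X")
      case True
      have "measure (path_measure M \<pi> t) (reach_within (Suc n) T) = (\<Sum>a\<in>UNIV. pmf (\<pi> ([], t)) a *
          step_value M (\<lambda>s'. measure (path_measure M (residual M \<pi> t a) s') (reach_within n T)) t a)"
        using True X by (intro measure_reach_within_Suc) auto
      also have "\<dots> \<le> (\<Sum>a\<in>UNIV. pmf (\<pi> ([], t)) a * W t)"
      proof (rule sum_mono)
        fix a
        show "pmf (\<pi> ([], t)) a *
            step_value M (\<lambda>s'. measure (path_measure M (residual M \<pi> t a) s') (reach_within n T)) t a
          \<le> pmf (\<pi> ([], t)) a * W t"
        proof (cases "a \<in> avail M t")
          case a: True
          have "step_value M (\<lambda>s'. measure (path_measure M (residual M \<pi> t a) s') (reach_within n T)) t a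
              \<le> step_value M ?Z t a"
            by (intro step_value_mono Suc.IH is_strategy_residual M Suc.prems a)
          also have "\<dots> \<le> W t"
            using step[OF True a] .
          finally show ?thesis
            by (rule mult_left_mono) simp
        next
          case False
          moreover have "set_pmf (\<pi> ([], t)) \<subseteq> avail M t"
            using Suc.prems unfolding is_strategy_def by (metis finite_path.simps(1) snd_conv)
          ultimately have "pmf (\<pi> ([], t)) a = 0"
            by (auto simp: set_pmf_iff)
          then show ?thesis by simp
        qed
      qed
      also have "\<dots> = W t"
        by (simp add: sum_distrib_right[symmetric] sum_pmf_eq_1)
      finally show ?thesis
        using le_V[OF Suc.prems, of t "Suc n"] True by simp
    qed (use le_V Suc.prems in simp)
  qed
  show ?thesis
  proof (rule pr_max_least[OF M])
    fix \<pi> assume "is_strategy M \<pi>"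
    from le_Z[OF this, of s] s
    show "measure (path_measure M \<pi> s) (reach T) \<le> W s"
      by (intro LIMSEQ_le_const2[OF reach_within_tendsto]) auto
  qed
qed

section \<open>Consistency of the updates\<close>

lemma finite_leave_values:
  fixes M :: "('s::finite, 'a::finite) mdp"
  shows "finite {step_value M U t a | t a. t \<in> T \<and> a \<in> avail M t - B}"
  by (rule finite_subset[of _ "case_prod (step_value M U) ` UNIV"]) auto

text \<open>The assumption on \<open>x\<close> covers the value 0 assigned when no action
  leaves.\<close>

lemma leave_value_le:
  assumes "0 \<le> x" "\<And>t a. t \<in> T \<Longrightarrow> a \<in> avail M t - B \<Longrightarrow> step_value M U t a \<le> x"
  shows "leave_value M U (T, B) \<le> x"
  unfolding leave_value_def using assms finite_leave_values[of M U T B]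
  by (auto simp: Let_def Max_le_iff)

lemma leave_value_less:
  assumes "0 < x" "\<And>t a. t \<in> T \<Longrightarrow> a \<in> avail M t - B \<Longrightarrow> step_value M U t a < x"
  shows "leave_value M U (T, B) < x"
  unfolding leave_value_def using assms finite_leave_values[of M U T B]
  by (auto simp: Let_def Max_less_iff)

lemma step_value_le_leave_value:
  assumes "t \<in> T" "a \<in> avail M t - B"
  shows "step_value M U t a \<le> leave_value M U (T, B)"
proof -
  have "step_value M U t a \<in> {step_value M U t a | t a. t \<in> T \<and> a \<in> avail M t - B}"
    using assms by blast
  then show ?thesis
    unfolding leave_value_def Let_def using finite_leave_values[of M U T B] by (auto intro: Max_ge)
qed

lemma leave_value_nonneg:
  assumes "\<And>t. 0 \<le> U t"
  shows "0 \<le> leave_value M U (T, B)"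
proof (cases "\<exists>t a. t \<in> T \<and> a \<in> avail M t - B")
  case True
  then obtain t a where t: "t \<in> T" "a \<in> avail M t - B"
    by blast
  show ?thesis
    by (rule order_trans[OF step_value_nonneg step_value_le_leave_value[OF t]]) (rule assms)
qed (auto simp: leave_value_def)

lemma leave_value_mono:
  assumes "\<And>t. 0 \<le> V t" "\<And>t. U t \<le> V t"
  shows "leave_value M U (T, B) \<le> leave_value M V (T, B)"
proof (rule leave_value_le)
  show "step_value M U t a \<le> leave_value M V (T, B)" if "t \<in> T" "a \<in> avail M t - B" for t a
    using step_value_mono[of M t a U V] assms(2) step_value_le_leave_value[OF that, of V]
    by (meson order_trans)
qed (rule leave_value_nonneg[OF assms(1)])

lemma Max_step_value_mono:
  fixes M :: "('s::finite, 'a::finite) mdp"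
  assumes "is_mdp M" "\<And>t. U t \<le> V t"
  shows "Max (step_value M U s ` avail M s) \<le> Max (step_value M V s ` avail M s)"
proof -
  have ne: "avail M s \<noteq> {}"
    using assms(1) by (simp add: is_mdp_def)
  have "step_value M U s a \<le> Max (step_value M V s ` avail M s)" if "a \<in> avail M s" for a
  proof -
    have "step_value M U s a \<le> step_value M V s a"
      by (intro step_value_mono assms(2))
    also have "\<dots> \<le> Max (step_value M V s ` avail M s)"
      using that by (intro Max_ge) auto
    finally show ?thesis .
  qed
  then show ?thesis
    using ne by (subst Max_le_iff) auto
qed

text \<open>The instance of \<open>pr_max_reach_le\<close> with \<open>X\<close> a singleton and
  \<open>W\<close> constantly equal to the maximum.\<close>

lemma pr_max_reach_le_Max_step_value:
  fixes M :: "('s::finite, 'a::finite) mdp"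
  assumes M: "is_mdp M" and s: "s \<notin> T"
  shows "pr_max M s (reach T) \<le> Max (step_value M (\<lambda>t. pr_max M t (reach T)) s ` avail M s)"
proof -
  let ?V = "\<lambda>t. pr_max M t (reach T)"
  let ?m = "Max (step_value M ?V s ` avail M s)"
  have le: "step_value M ?V s a \<le> ?m" if "a \<in> avail M s" for a
    using that by (intro Max_ge) auto
  obtain a where a: "a \<in> avail M s"
    using M unfolding is_mdp_def by blast
  have "0 \<le> ?m"
    by (rule order_trans[OF step_value_nonneg le[OF a]]) (rule pr_max_nonneg[OF M])
  moreover have "step_value M (\<lambda>t. if t \<in> {s} then min ?m (?V t) else ?V t) s a \<le> ?m"
    if "a \<in> avail M s" for a
    by (rule order_trans[OF step_value_mono le[OF that]]) auto
  ultimately show ?thesis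
    using s by (intro pr_max_reach_le[OF M, of "{s}"]) auto
qed

text \<open>Take \<open>W\<close> constantly equal to the leaving value \<open>?m\<close>. An action
  of the component stays in \<open>X\<close> and averages values of at most \<open>?m\<close>; any
  other action contributes at most \<open>?m\<close> by the definition of
  \<open>leave_value\<close>.\<close>

lemma pr_max_reach_le_leave_value:
  fixes M :: "('s::finite, 'a::finite) mdp"
  assumes M: "is_mdp M" and E: "end_component M (X, B)" and X: "X \<inter> T = {}" and s: "s \<in> X"
  shows "pr_max M s (reach T) \<le> leave_value M (\<lambda>t. pr_max M t (reach T)) (X, B)"
proof -
  let ?V = "\<lambda>t. pr_max M t (reach T)"
  let ?m = "leave_value M ?V (X, B)"
  have m: "0 \<le> ?m"
    by (rule leave_value_nonneg) (rule pr_max_nonneg[OF M])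
  show ?thesis
  proof (rule pr_max_reach_le[OF M X m _ s])
    fix t a assume t: "t \<in> X" and a: "a \<in> avail M t"
    let ?Z = "\<lambda>t. if t \<in> X then min ?m (?V t) else ?V t"
    show "step_value M ?Z t a \<le> ?m"
    proof (cases "a \<in> B")
      case True
      then have "set_pmf (delta M t a) \<subseteq> X"
        using E t a by (auto simp: end_component_def)
      then have "step_value M ?Z t a \<le> step_value M (\<lambda>_. ?m) t a"
        by (intro step_value_mono) auto
      then show ?thesis
        by (simp add: step_value_const)
    next
      case False
      have "step_value M ?Z t a \<le> step_value M ?V t a"
        by (intro step_value_mono) auto
      also have "\<dots> \<le> ?m"
        using False t a by (intro step_value_le_leave_value) auto
      finally show ?thesis .
    qed
  qed
qed

section \<open>Bounds on a single iteration, whatever the order of its updates\<close>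

lemma update_ec_le: "update_ec M E U \<le> U"
  by (auto simp: update_ec_def le_fun_def)

lemma update_state_le: "update_state M s U \<le> U"
  by (auto simp: update_state_def le_fun_def)

lemma fold_le:
  fixes U :: "'s \<Rightarrow> real"
  assumes "\<And>x W. f x W \<le> W"
  shows "fold f xs U \<le> U"
  by (rule fold_invariant[where Q = "\<lambda>_. True" and P = "\<lambda>W. W \<le> U"])
    (auto intro: order_trans[OF assms])

text \<open>The updates before \<open>x\<close> only replace \<open>U\<close> by some smaller
  \<open>W\<close>, and those after it cannot raise the value again. The bound therefore holds
  wherever \<open>x\<close> occurs in the list.\<close>

lemma fold_update_le:
  fixes U :: "'s \<Rightarrow> real"
  assumes le: "\<And>x W. f x W \<le> W" and x: "x \<in> set xs" and b: "\<And>W. W \<le> U \<Longrightarrow> f x W s \<le> b"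
  shows "fold f xs U s \<le> b"
proof -
  obtain ys zs where xs: "xs = ys @ x # zs"
    using split_list[OF x] by blast
  have "fold f zs (f x (fold f ys U)) s \<le> f x (fold f ys U) s"
    using fold_le[of f zs, OF le] by (simp add: le_fun_def)
  also have "\<dots> \<le> b"
    by (intro b fold_le le)
  finally show ?thesis
    by (simp add: xs)
qed

lemma learn_step_le:
  assumes "learn_step M \<rho> (C, U) (C', U')"
  shows "U' \<le> U"
proof -
  obtain Es ss where "U' = fold (update_state M) ss (fold (update_ec M) Es U)"
    using assms unfolding learn_step_def by auto
  also have "\<dots> \<le> fold (update_ec M) Es U"
    by (rule fold_le[OF update_state_le])
  also have "\<dots> \<le> U"
    by (rule fold_le[OF update_ec_le])
  finally show ?thesis .
qed

text \<open>Exploring more states shrinks the target, so the invariant survives the change of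
  \<open>C\<close>. Each update is monotone, and its value at \<open>pr_max\<close> is at least
  \<open>pr_max\<close> on the updated states; hence it keeps any function above
  \<open>pr_max\<close> there.\<close>

lemma learn_step_consistent:
  fixes M :: "('s::finite, 'a::finite) mdp"
  assumes M: "is_mdp M" and step: "learn_step M \<rho> (C, U) (C', U')"
    and U: "\<And>s. pr_max M s (reach (- C)) \<le> U s"
  shows "pr_max M s (reach (- C')) \<le> U' s"
proof -
  let ?V = "\<lambda>s. pr_max M s (reach (- C'))"
  obtain Es ss where C': "C' = C \<union> path_states \<rho>" and Es: "set Es = max_end_components M C'"
    and ss: "set ss = path_states \<rho>"
    and U': "U' = fold (update_state M) ss (fold (update_ec M) Es U)"
    using step unfolding learn_step_def by auto
  have V: "\<forall>s. ?V s \<le> U s"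
    using pr_max_reach_mono[OF M, of "- C'" "- C"] U C' by (auto intro: order_trans)
  have "\<forall>s. ?V s \<le> fold (update_ec M) Es U s"
  proof (rule fold_invariant[where Q = "\<lambda>E. E \<in> max_end_components M C'"
      and P = "\<lambda>W. \<forall>s. ?V s \<le> W s"])
    fix E W assume E: "E \<in> max_end_components M C'" and W: "\<forall>s. ?V s \<le> W s"
    obtain X B where XB: "E = (X, B)" by force
    have "?V s \<le> leave_value M W E" if "s \<in> X" for s
    proof -
      have "?V s \<le> leave_value M ?V E"
        using E that unfolding XB max_end_components_def
        by (intro pr_max_reach_le_leave_value[OF M]) auto
      also have "\<dots> \<le> leave_value M W E"
        unfolding XB by (rule leave_value_mono) (use W pr_max_nonneg[OF M] order_trans in blast)+
      finally show ?thesis .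
    qed
    then show "\<forall>s. ?V s \<le> update_ec M E W s"
      using W by (simp add: update_ec_def XB)
  qed (use Es V in auto)
  then have "\<forall>s. ?V s \<le> fold (update_state M) ss (fold (update_ec M) Es U) s"
  proof (rule fold_invariant[where Q = "\<lambda>s. s \<in> C'" and P = "\<lambda>W. \<forall>s. ?V s \<le> W s", rotated])
    fix s W assume s: "s \<in> C'" and W: "\<forall>s. ?V s \<le> W s"
    have "?V s \<le> Max (step_value M ?V s ` avail M s)"
      using s by (intro pr_max_reach_le_Max_step_value[OF M]) auto
    also have "\<dots> \<le> Max (step_value M W s ` avail M s)"
      using W by (intro Max_step_value_mono[OF M]) auto
    finally show "\<forall>t. ?V t \<le> update_state M s W t"
      using W by (simp add: update_state_def)
  qed (use ss C' in auto)
  then show ?thesis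
    by (simp add: U')
qed

text \<open>Bounding the new value through \<open>U\<close> as it was before the whole iteration
  hides the intermediate updates. The limit argument for termination uses this bound and the next
  one.\<close>

lemma learn_step_le_Max_step_value:
  fixes M :: "('s::finite, 'a::finite) mdp"
  assumes M: "is_mdp M" and step: "learn_step M \<rho> (C, U) (C', U')" and s: "s \<in> path_states \<rho>"
  shows "U' s \<le> Max (step_value M U s ` avail M s)"
proof -
  obtain Es ss where ss: "set ss = path_states \<rho>"
    and U': "U' = fold (update_state M) ss (fold (update_ec M) Es U)"
    using step unfolding learn_step_def by auto
  show ?thesis
    unfolding U'
  proof (rule fold_update_le[OF update_state_le])
    fix W assume "W \<le> fold (update_ec M) Es U"
    also have "\<dots> \<le> U"
      by (rule fold_le[OF update_ec_le])
    finally have "Max (step_value M W s ` avail M s) \<le> Max (step_value M U s ` avail M s)"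
      by (intro Max_step_value_mono[OF M]) (simp add: le_fun_def)
    then show "update_state M s W s \<le> Max (step_value M U s ` avail M s)"
      by (simp add: update_state_def)
  qed (simp add: s ss)
qed

lemma learn_step_le_leave_value:
  fixes M :: "('s::finite, 'a::finite) mdp"
  assumes step: "learn_step M \<rho> (C, U) (C', U')" and U: "\<And>s. 0 \<le> U s"
    and E: "E \<in> max_end_components M C'" and s: "s \<in> fst E"
  shows "U' s \<le> leave_value M U E"
proof -
  obtain Es ss where Es: "set Es = max_end_components M C'"
    and U': "U' = fold (update_state M) ss (fold (update_ec M) Es U)"
    using step unfolding learn_step_def by auto
  have "U' s \<le> fold (update_ec M) Es U s"
    using fold_le[of "update_state M" ss, OF update_state_le] by (simp add: U' le_fun_def)
  also have "\<dots> \<le> leave_value M U E"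
  proof (rule fold_update_le[OF update_ec_le])
    fix W assume "W \<le> U"
    then have "leave_value M W E \<le> leave_value M U E"
      by (cases E) (auto intro!: leave_value_mono U simp: le_fun_def)
    then show "update_ec M E W s \<le> leave_value M U E"
      using s by (simp add: update_ec_def)
  qed (simp add: E Es)
  finally show ?thesis .
qed

section \<open>End components and closed sets\<close>

lemma max_end_component_above:
  fixes M :: "('s::finite, 'a::finite) mdp"
  assumes "end_component M (T, B)" "T \<subseteq> C"
  obtains T' B' where "(T', B') \<in> max_end_components M C" "T \<subseteq> T'" "B \<subseteq> B'"
proof -
  let ?A = "{(T, B). end_component M (T, B) \<and> T \<subseteq> C}"
  have "\<exists>E\<in>?A. (T, B) \<le> E \<and> (\<forall>E'\<in>?A. E \<le> E' \<longrightarrow> E = E')"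
    using assms by (intro finite_has_maximal2) auto
  then obtain T' B' where "(T', B') \<in> ?A" "(T, B) \<le> (T', B')"
    and max: "\<forall>E\<in>?A. (T', B') \<le> E \<longrightarrow> (T', B') = E"
    by (metis (no_types, lifting) surj_pair)
  then show ?thesis
    by (intro that[of T' B']) (auto simp: max_end_components_def less_eq_prod_def)
qed

lemma path_states_subset_closed:
  assumes "finite_path M \<rho>" "path_states \<rho> \<subseteq> T" "path_actions \<rho> \<subseteq> B" "first_state \<rho> \<in> R"
    and "\<And>t a. t \<in> R \<inter> T \<Longrightarrow> a \<in> B \<inter> avail M t \<Longrightarrow> set_pmf (delta M t a) \<subseteq> R"
  shows "path_states \<rho> \<subseteq> R"
  using assms
proof (induction M \<rho> rule: finite_path.induct)
  case (2 M t a h s)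
  have "path_states (h, s) \<subseteq> R"
    using 2(2-5) by (intro "2.IH" "2.prems"(5)) (auto simp: path_states_def path_actions_def
        dest: subsetD[OF "2.prems"(5), rotated -1])
  then show ?case
    using 2 by (auto simp: path_states_def)
qed (simp add: path_states_def)

text \<open>By strong connectedness every state of \<open>T\<close> is reached from a common state
  of \<open>T\<close> and \<open>R\<close> along a path of the component, and such a path cannot
  leave \<open>R\<close>.\<close>

lemma end_component_subset_closed:
  assumes "end_component M (T, B)" "T \<inter> R \<noteq> {}"
    and "\<And>t a. t \<in> R \<inter> T \<Longrightarrow> a \<in> B \<inter> avail M t \<Longrightarrow> set_pmf (delta M t a) \<subseteq> R"
  shows "T \<subseteq> R"
proof
  fix t assume t: "t \<in> T"
  obtain s where s: "s \<in> T" "s \<in> R"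
    using assms(2) by blast
  then obtain \<rho> where \<rho>: "finite_path M \<rho>" "first_state \<rho> = s" "snd \<rho> = t" "path_states \<rho> \<subseteq> T"
    "path_actions \<rho> \<subseteq> B"
    using assms(1) t unfolding end_component_def by blast
  then have "path_states \<rho> \<subseteq> R"
    using s by (intro path_states_subset_closed[OF _ _ _ _ assms(3)]) auto
  with \<rho>(3) show "t \<in> R"
    by (auto simp: path_states_def)
qed

lemma first_state_snoc: "first_state (h @ [(t, a)], s) = first_state (h, t)"
  by (cases h) auto

lemma finite_path_snoc:
  "finite_path M (h @ [(t, a)], s) \<longleftrightarrow>
    finite_path M (h, t) \<and> a \<in> avail M t \<and> s \<in> set_pmf (delta M t a)"
  by (induction h) (auto simp: first_state_snoc)

text \<open>
  A minimal set \<open>R\<close> closed under the actions \<open>K\<close> below is an end component. Any maximal end component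
  containing \<open>R\<close> meets \<open>D\<close>, so its actions are in \<open>K\<close>, and it cannot be larger than \<open>R\<close>.
  An action leaving it into \<open>D\<close> would itself be in \<open>K\<close>, hence an action of that end component. One cannot
  take \<open>R\<close> inside \<open>D\<close>: \<open>L\<close> may vary on an end component, since \<open>U\<^sub>0\<close> may be too small on part of it
  to satisfy the Bellman inequality.
\<close>

lemma max_end_component_leaving:
  fixes M :: "('s::finite, 'a::finite) mdp"
  assumes M: "is_mdp M" and D: "D \<noteq> {}" "D \<subseteq> C"
    and stay: "\<And>s. s \<in> D \<Longrightarrow> \<exists>a\<in>avail M s. set_pmf (delta M s a) \<subseteq> D"
  obtains T B where "(T, B) \<in> max_end_components M C" "T \<inter> D \<noteq> {}"
    "\<And>t a. t \<in> T \<Longrightarrow> a \<in> avail M t - B \<Longrightarrow> \<not> set_pmf (delta M t a) \<subseteq> D"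
proof -
  let ?MEC = "{(T, B) \<in> max_end_components M C. T \<inter> D \<noteq> {}}"
  let ?G = "D \<union> \<Union> (fst ` ?MEC)"
  \<comment> \<open>The actions that stay in \<open>D\<close>, together with the internal actions of
    the maximal end components that meet \<open>D\<close>.\<close>
  define K where "K = {(t, a). t \<in> C \<and> a \<in> avail M t \<and>
    (set_pmf (delta M t a) \<subseteq> D \<or> (\<exists>(T, B)\<in>?MEC. t \<in> T \<and> a \<in> B))}"
  define closed where "closed R \<longleftrightarrow> R \<noteq> {} \<and> R \<subseteq> ?G \<and>
    (\<forall>t a. t \<in> R \<longrightarrow> (t, a) \<in> K \<longrightarrow> set_pmf (delta M t a) \<subseteq> R)" for R
  have ec: "end_component M (T, B)" "T \<subseteq> C" if "(T, B) \<in> ?MEC" for T B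
    using that by (auto simp: max_end_components_def)
  \<comment> \<open>This shows that some closed set exists, so by finiteness there is a minimal
    one.\<close>
  have "closed ?G"
    unfolding closed_def
  proof (intro conjI allI impI)
    fix t a assume "t \<in> ?G" and K: "(t, a) \<in> K"
    show "set_pmf (delta M t a) \<subseteq> ?G"
    proof (cases "set_pmf (delta M t a) \<subseteq> D")
      case False
      then obtain T B where E: "(T, B) \<in> ?MEC" "t \<in> T" "a \<in> B" "a \<in> avail M t"
        using K unfolding K_def by auto
      then have "set_pmf (delta M t a) \<subseteq> T"
        using ec(1)[OF E(1)] unfolding end_component_def by auto
      also have "T \<subseteq> ?G"
        using E(1) by force
      finally show ?thesis .
    qed blast
  qed (use D in auto)
  then obtain R where R: "closed R" and minimal: "\<And>R'. closed R' \<Longrightarrow> R' \<subseteq> R \<Longrightarrow> R' = R"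
    using finite_has_minimal[of "Collect closed"] by auto
  have R_closed: "set_pmf (delta M t a) \<subseteq> R" if "t \<in> R" "(t, a) \<in> K" for t a
    using R that unfolding closed_def by blast
  have "?G \<subseteq> C"
    using D(2) by (auto simp: max_end_components_def)
  then have R_sub: "R \<subseteq> C"
    using R unfolding closed_def by blast
  \<comment> \<open>A state of \<open>R\<close> outside \<open>D\<close> belongs to a component
    meeting \<open>D\<close>. The internal actions of that component are in \<open>K\<close>, so
    \<open>R\<close> contains the whole component and thus a state of \<open>D\<close>.\<close>
  have "R \<inter> D \<noteq> {}"
  proof -
    obtain r where r: "r \<in> R" "r \<in> ?G"
      using R unfolding closed_def by blast
    show ?thesis
    proof (cases "r \<in> D")
      case False
      then obtain T B where E: "(T, B) \<in> ?MEC" "r \<in> T"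
        using r(2) by auto
      have "T \<subseteq> R"
      proof (rule end_component_subset_closed[OF ec(1)[OF E(1)]])
        fix t a assume "t \<in> R \<inter> T" "a \<in> B \<inter> avail M t"
        then have "(t, a) \<in> K"
          using E(1) ec(2)[OF E(1)] unfolding K_def by auto
        then show "set_pmf (delta M t a) \<subseteq> R"
          using R_closed \<open>t \<in> R \<inter> T\<close> by blast
      qed (use r E in auto)
      then show ?thesis
        using E(1) by auto
    qed (use r in auto)
  qed
  define B where "B = {a. \<exists>t\<in>R. (t, a) \<in> K}"
  have "end_component M (R, B)"
    unfolding end_component_def prod.case
  proof (intro conjI ballI)
    show "R \<noteq> {}"
      using R by (simp add: closed_def)
    obtain s where s: "s \<in> R" "s \<in> D"
      using \<open>R \<inter> D \<noteq> {}\<close> by blast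
    then obtain a where "(s, a) \<in> K"
      using stay[OF s(2)] D(2) unfolding K_def by auto
    with s show "B \<noteq> {}"
      by (auto simp: B_def)
    show "B \<subseteq> \<Union> (avail M ` R)"
      by (auto simp: B_def K_def)
  next
    fix s a assume s: "s \<in> R" and a: "a \<in> B \<inter> avail M s"
    then obtain t where t: "t \<in> R" "(t, a) \<in> K"
      by (auto simp: B_def)
    then have "a \<in> avail M t"
      by (simp add: K_def)
    \<comment> \<open>An action of \<open>B\<close> might have entered at another state of
      \<open>R\<close>; disjointness of the available actions rules this out.\<close>
    then have "t = s"
      using a M unfolding is_mdp_def by blast
    with t R_closed show "set_pmf (delta M s a) \<subseteq> R"
      by blast
  next
    fix s s' assume s: "s \<in> R" "s' \<in> R"
    let ?path = "\<lambda>t \<rho>. finite_path M \<rho> \<and> first_state \<rho> = s \<and> snd \<rho> = t \<and>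
      path_states \<rho> \<subseteq> R \<and> path_actions \<rho> \<subseteq> B"
    \<comment> \<open>The states reachable from \<open>s\<close> within \<open>(R, B)\<close>. This
      set is closed, so minimality of \<open>R\<close> makes it all of \<open>R\<close>, which is
      strong connectedness.\<close>
    define S where "S = {t. \<exists>\<rho>. ?path t \<rho>}"
    have sub: "S \<subseteq> R"
      by (auto simp: S_def path_states_def)
    have "?path s ([], s)"
      using s by (simp add: path_states_def path_actions_def)
    then have "s \<in> S"
      unfolding S_def by blast
    have succ: "set_pmf (delta M t a) \<subseteq> S" if t: "t \<in> S" and K: "(t, a) \<in> K" for t a
    proof
      fix u assume u: "u \<in> set_pmf (delta M t a)"
      obtain \<rho> where \<rho>: "?path t \<rho>"
        using t unfolding S_def by blast
      have "t \<in> R" "(fst \<rho>, t) = \<rho>"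
        using t sub \<rho> by auto
      moreover have "u \<in> R"
        using R_closed[OF \<open>t \<in> R\<close> K] u by blast
      moreover have "a \<in> B" "a \<in> avail M t"
        using K \<open>t \<in> R\<close> by (auto simp: B_def K_def)
      ultimately have "?path u (fst \<rho> @ [(t, a)], u)"
        using \<rho> u by (auto simp: finite_path_snoc first_state_snoc path_states_def path_actions_def)
      then show "u \<in> S"
        unfolding S_def by blast
    qed
    have "R \<subseteq> ?G"
      using R by (simp only: closed_def)
    with sub have "S \<subseteq> ?G"
      by (rule subset_trans)
    with \<open>s \<in> S\<close> succ have "closed S"
      unfolding closed_def by blast
    then have "S = R"
      using sub by (rule minimal)
    with s show "\<exists>\<rho>. ?path s' \<rho>"
      unfolding S_def by blast
  qed
  then obtain T' B' where E: "(T', B') \<in> max_end_components M C" "R \<subseteq> T'" "B \<subseteq> B'"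
    using R_sub by (rule max_end_component_above)
  then have MEC: "(T', B') \<in> ?MEC"
    using \<open>R \<inter> D \<noteq> {}\<close> by auto
  \<comment> \<open>Since \<open>T'\<close> meets \<open>D\<close>, its internal actions are in
    \<open>K\<close> and so cannot lead out of \<open>R\<close>.\<close>
  have "T' \<subseteq> R"
  proof (rule end_component_subset_closed[OF ec(1)[OF MEC]])
    show "T' \<inter> R \<noteq> {}"
      using E(2) \<open>R \<inter> D \<noteq> {}\<close> by blast
    fix t a assume t: "t \<in> R \<inter> T'" "a \<in> B' \<inter> avail M t"
    then have "(t, a) \<in> K"
      using MEC ec(2)[OF MEC] unfolding K_def by auto
    then show "set_pmf (delta M t a) \<subseteq> R"
      using R_closed t by blast
  qed
  show thesis
  proof (rule that[OF E(1)])
    show "T' \<inter> D \<noteq> {}"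
      using MEC by simp
    fix t a assume t: "t \<in> T'" "a \<in> avail M t - B'"
    show "\<not> set_pmf (delta M t a) \<subseteq> D"
    proof
      assume "set_pmf (delta M t a) \<subseteq> D"
      then have "(t, a) \<in> K"
        using t ec(2)[OF MEC] by (auto simp: K_def)
      then have "a \<in> B"
        using t \<open>T' \<subseteq> R\<close> by (auto simp: B_def)
      with E(3) t show False
        by blast
    qed
  qed
qed

section \<open>Termination\<close>

lemma step_value_less:
  assumes "\<And>t. t \<in> set_pmf (delta M s a) \<Longrightarrow> U t \<le> x" "t \<in> set_pmf (delta M s a)" "U t < x"
  shows "step_value M U s a < x"
proof -
  have "step_value M U s a < step_value M (\<lambda>_. x) s a"
    unfolding step_value_def
  proof (rule sum_strict_mono_ex1)
    show "\<forall>t\<in>UNIV. pmf (delta M s a) t * U t \<le> pmf (delta M s a) t * x"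
      using assms(1) by (metis mult_left_mono pmf_nonneg mult_zero_left set_pmf_iff order_refl)
    show "\<exists>t\<in>UNIV. pmf (delta M s a) t * U t < pmf (delta M s a) t * x"
      using assms(2,3) by (auto simp: pmf_positive intro!: exI[of _ t])
  qed simp
  then show ?thesis
    by (simp add: step_value_const)
qed

section \<open>Runs of the algorithm\<close>

lemma run_learn_step:
  assumes "learn_core_run M \<epsilon> C\<^sub>0 U\<^sub>0 smp \<omega> c \<rho>" "\<not> halted M \<epsilon> (c n)"
  shows "learn_step M (\<rho> n) (c n) (c (Suc n))"
  using assms unfolding learn_core_run_def by metis

lemma run_halted:
  assumes "learn_core_run M \<epsilon> C\<^sub>0 U\<^sub>0 smp \<omega> c \<rho>" "halted M \<epsilon> (c n)"
  shows "c (Suc n) = c n"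
  using assms unfolding learn_core_run_def by metis

text \<open>Serves twice: it yields the core property on halting, and nonnegativity of
  \<open>U\<close> in the termination argument.\<close>

lemma run_consistent:
  fixes M :: "('s::finite, 'a::finite) mdp"
  assumes M: "is_mdp M" and run: "learn_core_run M \<epsilon> C\<^sub>0 U\<^sub>0 smp \<omega> c \<rho>"
    and U\<^sub>0: "\<And>s. pr_max M s (reach (- C\<^sub>0)) \<le> U\<^sub>0 s"
  shows "pr_max M s (reach (- fst (c n))) \<le> snd (c n) s"
proof (induction n arbitrary: s)
  case 0
  then show ?case
    using run U\<^sub>0 by (simp add: learn_core_run_def)
next
  case (Suc n)
  show ?case
  proof (cases "halted M \<epsilon> (c n)")
    case True
    then show ?thesis
      using Suc run_halted[OF run] by simp
  next
    case False
    then show ?thesis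
      using learn_step_consistent[OF M, of "\<rho> n" "fst (c n)" "snd (c n)"] Suc run_learn_step[OF run]
      by simp
  qed
qed

lemma fair_run_terminates:
  fixes M :: "('s::finite, 'a::finite) mdp"
  assumes M: "is_mdp M" and \<epsilon>: "0 < \<epsilon>" and init: "init M \<in> C\<^sub>0"
    and U\<^sub>0: "\<And>s. pr_max M s (reach (- C\<^sub>0)) \<le> U\<^sub>0 s"
    and run: "learn_core_run M \<epsilon> C\<^sub>0 U\<^sub>0 smp \<omega> c \<rho>" and fair: "fair_run M \<epsilon> c \<rho>"
  shows "terminates M \<epsilon> c"
proof (rule ccontr)
  assume nt: "\<not> terminates M \<epsilon> c"
  define C where "C n = fst (c n)" for n
  define U where "U n = snd (c n)" for n
  have step: "learn_step M (\<rho> n) (C n, U n) (C (Suc n), U (Suc n))" for n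
    using nt run_learn_step[OF run] by (simp add: C_def U_def terminates_def)
  have nonneg: "0 \<le> U n s" for n s
    using run_consistent[OF M run U\<^sub>0] pr_max_nonneg[OF M] unfolding U_def by (rule order_trans[rotated])
  have dec: "decseq (\<lambda>n. U n s)" for s
    using learn_step_le[OF step] by (intro decseq_SucI) (simp add: le_fun_def)
  have "\<exists>l. (\<lambda>n. U n s) \<longlonglongrightarrow> l" for s
    using decseq_convergent[OF dec, of 0 s] nonneg by metis
  then obtain L where L: "\<And>s. (\<lambda>n. U n s) \<longlonglongrightarrow> L s"
    by metis
  have L_le: "L s \<le> U n s" for n s
    by (rule decseq_ge[OF dec L])
  have step_lim: "(\<lambda>n. step_value M (U n) s a) \<longlonglongrightarrow> step_value M L s a" for s a
    unfolding step_value_def by (intro tendsto_intros L)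

  have C_Suc: "C (Suc n) = C n \<union> path_states (\<rho> n)" for n
    using step[of n] by (simp add: learn_step_def)
  have C_mono: "C m \<subseteq> C n" if "m \<le> n" for m n
    by (rule lift_Suc_mono_le[OF _ that]) (simp add: C_Suc)
  \<comment> \<open>An increasing sequence of subsets of a finite set is constant from the index of
    greatest cardinality on.\<close>
  obtain N where "\<And>n. card (C n) \<le> card (C N)"
    using ex_has_greatest_nat[of "\<lambda>_. True" 0 "\<lambda>n. card (C n)" "Suc (card (UNIV :: 's set))"]
    by (auto simp: card_mono less_Suc_eq_le)
  then have C_N: "C n = C N" if "n \<ge> N" for n
    using C_mono[OF that] by (metis card_seteq finite)
  have path: "path_states (\<rho> n) \<subseteq> C N" if "n \<ge> N" for n
    using C_Suc[of n] C_N[of n] C_N[of "Suc n"] that by auto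
  have closed: "set_pmf (delta M t a) \<subseteq> C N" if "t \<in> C N" "a \<in> avail M t" for t a
  proof (rule ccontr)
    assume "\<not> set_pmf (delta M t a) \<subseteq> C N"
    then obtain s where s: "s \<in> set_pmf (delta M t a)" "s \<notin> C N"
      by blast
    then have "partially_explored M (fst (c N)) s"
      using that by (auto simp: partially_explored_def C_def)
    \<comment> \<open>Fairness would put \<open>s\<close> on a path sampled at or after
      \<open>N\<close>, but all those paths stay in \<open>C N\<close>.\<close>
    then show False
      using fair nt path s(2) unfolding fair_run_def by blast
  qed
  have init_C: "init M \<in> C N"
    using C_mono[of 0 N] init run by (auto simp: C_def learn_core_run_def)

  define u where "u = Max (L ` C N)"
  define D where "D = {s \<in> C N. L s = u}"
  have L_u: "L s \<le> u" if "s \<in> C N" for s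
    using that by (simp add: u_def)
  have "u \<le> 0"
  proof (rule ccontr)
    assume "\<not> u \<le> 0"
    then have u: "0 < u" by simp
    \<comment> \<open>On \<open>C N\<close> the values of \<open>L\<close> are at most
      \<open>u\<close>, so an average that attains \<open>u\<close> puts all its mass on
      \<open>D\<close>.\<close>
    have supp: "set_pmf (delta M t a) \<subseteq> D"
      if "t \<in> C N" "a \<in> avail M t" "\<not> step_value M L t a < u" for t a
    proof
      fix s assume s: "s \<in> set_pmf (delta M t a)"
      have "\<not> L s < u"
        using step_value_less[of M t a L u s] that closed[OF that(1,2)] L_u s by blast
      then show "s \<in> D"
        using L_u[of s] closed[OF that(1,2)] s by (auto simp: D_def)
    qed
    have "u \<in> L ` C N"
      unfolding u_def using init_C by (intro Max_in) auto
    then have ne: "D \<noteq> {}"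
      by (auto simp: D_def)
    have stay: "\<exists>a\<in>avail M s. set_pmf (delta M s a) \<subseteq> D" if s: "s \<in> D" for s
    proof (rule ccontr)
      assume "\<not> ?thesis"
      then have "\<forall>a\<in>avail M s. step_value M L s a < u"
        using supp s by (auto simp: D_def)
      \<comment> \<open>There are finitely many actions, so the strict inequalities at the limit
        hold simultaneously for all large \<open>n\<close>.\<close>
      then have "\<forall>\<^sub>F n in sequentially. \<forall>a\<in>avail M s. step_value M (U n) s a < u"
        by (intro eventually_ball_finite) (auto intro: order_tendstoD(2)[OF step_lim])
      then obtain k where k: "\<And>n a. n \<ge> k \<Longrightarrow> a \<in> avail M s \<Longrightarrow> step_value M (U n) s a < u"
        by (auto simp: eventually_sequentially)
      \<comment> \<open>The value at \<open>s\<close> never falls below \<open>L s = u\<close>,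
        which is positive, so fairness provides a late enough iteration that updates
        \<open>s\<close>.\<close>
      have "s \<in> fst (c N)" "\<forall>m\<ge>N. 0 < snd (c m) s"
        using s u L_le[of s] unfolding D_def C_def U_def by (auto intro: less_le_trans)
      then have "\<exists>\<^sub>\<infinity>m. s \<in> path_states (\<rho> m)"
        using fair nt unfolding fair_run_def by blast
      then obtain m where m: "m \<ge> k" "s \<in> path_states (\<rho> m)"
        unfolding INFM_nat_le by blast
      have "L s \<le> U (Suc m) s"
        by (rule L_le)
      also have "\<dots> \<le> Max (step_value M (U m) s ` avail M s)"
        by (rule learn_step_le_Max_step_value[OF M step m(2)])
      also have "\<dots> < u"
        using k[OF m(1)] M unfolding is_mdp_def by (subst Max_less_iff) auto
      finally show False
        using s by (simp add: D_def)
    qed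
    have "D \<subseteq> C N"
      by (auto simp: D_def)
    then obtain T B where E: "(T, B) \<in> max_end_components M (C N)" and TD: "T \<inter> D \<noteq> {}"
      and leave: "\<And>t a. t \<in> T \<Longrightarrow> a \<in> avail M t - B \<Longrightarrow> \<not> set_pmf (delta M t a) \<subseteq> D"
      using max_end_component_leaving[OF M ne _ stay] by blast
    have "\<forall>t\<in>T. \<forall>a\<in>avail M t - B. step_value M L t a < u"
    proof (intro ballI)
      fix t a assume t: "t \<in> T" "a \<in> avail M t - B"
      have "t \<in> C N"
        using E t(1) by (auto simp: max_end_components_def)
      then show "step_value M L t a < u"
        using leave[OF t] supp[of t a] t(2) by blast
    qed
    then have "\<forall>\<^sub>F n in sequentially. \<forall>t\<in>T. \<forall>a\<in>avail M t - B. step_value M (U n) t a < u"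
      by (intro eventually_ball_finite ballI) (auto intro: order_tendstoD(2)[OF step_lim])
    then obtain k where k: "\<And>n. n \<ge> k \<Longrightarrow> \<forall>t\<in>T. \<forall>a\<in>avail M t - B. step_value M (U n) t a < u"
      by (auto simp: eventually_sequentially)
    \<comment> \<open>Beyond \<open>k\<close> all leaving values are below \<open>u\<close>; beyond
      \<open>N\<close> the component \<open>(T, B)\<close> is among those that the iteration
      updates.\<close>
    define n where "n = max k N"
    obtain s where s: "s \<in> T" "s \<in> D"
      using TD by blast
    have "L s \<le> U (Suc n) s"
      by (rule L_le)
    also have "\<dots> \<le> leave_value M (U n) (T, B)"
      using E s C_N[of "Suc n"] by (intro learn_step_le_leave_value[OF step nonneg]) (auto simp: n_def)
    also have "\<dots> < u"
      using k[of n] u by (intro leave_value_less) (auto simp: n_def)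
    finally show False
      using s by (simp add: D_def)
  qed
  then have "L (init M) < \<epsilon>"
    using L_u[OF init_C] \<epsilon> by linarith
  then have "\<forall>\<^sub>F n in sequentially. U n (init M) < \<epsilon>"
    by (intro order_tendstoD(2)[OF L])
  then obtain n where "U n (init M) < \<epsilon>"
    by (auto simp: eventually_sequentially)
  then have "terminates M \<epsilon> c"
    by (auto simp: terminates_def halted_def U_def case_prod_beta intro!: exI[of _ n])
  with nt show False ..
qed

theorem theorem3p8:
  fixes M :: "('s::finite, 'a::finite) mdp"
    and \<epsilon> :: real
    and C\<^sub>0 :: "'s set"
    and U\<^sub>0 :: "'s \<Rightarrow> real"
    and \<Omega> :: "'w measure"
    and smp :: "('s, 'a, 'w) sampler"
    and c :: "'w \<Rightarrow> nat \<Rightarrow> 's config"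
    and \<rho> :: "'w \<Rightarrow> nat \<Rightarrow> ('s, 'a) fpath"
  assumes "is_mdp M"
    and "\<epsilon> > 0"
    and "init M \<in> C\<^sub>0"
    and "\<And>s. U\<^sub>0 s \<in> {0..1}"
    and "\<And>s. U\<^sub>0 s \<ge> pr_max M s (reach (- C\<^sub>0))"
    and "path_sampler M \<Omega> smp"
    and "\<And>\<omega>. \<omega> \<in> space \<Omega> \<Longrightarrow> learn_core_run M \<epsilon> C\<^sub>0 U\<^sub>0 smp \<omega> (c \<omega>) (\<rho> \<omega>)"
  shows "((\<forall>\<omega>\<in>space \<Omega>. fair_run M \<epsilon> (c \<omega>) (\<rho> \<omega>)) \<longrightarrow> (\<forall>\<omega>\<in>space \<Omega>. terminates M \<epsilon> (c \<omega>))) \<and>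
    ((AE \<omega> in \<Omega>. fair_run M \<epsilon> (c \<omega>) (\<rho> \<omega>)) \<longrightarrow> (AE \<omega> in \<Omega>. terminates M \<epsilon> (c \<omega>))) \<and>
    (\<forall>\<omega>\<in>space \<Omega>. \<forall>n. halted M \<epsilon> (c \<omega> n) \<longrightarrow> is_core M \<epsilon> (fst (c \<omega> n)))"
proof (intro conjI impI ballI allI)
  \<comment> \<open>Fairness implies termination for each seed separately, so the sure and the
    almost sure claims both follow pointwise.\<close>
  have term_fair: "terminates M \<epsilon> (c \<omega>)" if "\<omega> \<in> space \<Omega>" "fair_run M \<epsilon> (c \<omega>) (\<rho> \<omega>)" for \<omega>
    using fair_run_terminates[OF assms(1-3,5,7)] that by blast
  show "terminates M \<epsilon> (c \<omega>)"
    if "\<forall>\<omega>\<in>space \<Omega>. fair_run M \<epsilon> (c \<omega>) (\<rho> \<omega>)" "\<omega> \<in> space \<Omega>" for \<omega>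
    using that term_fair by blast
  show "AE \<omega> in \<Omega>. terminates M \<epsilon> (c \<omega>)" if "AE \<omega> in \<Omega>. fair_run M \<epsilon> (c \<omega>) (\<rho> \<omega>)"
    using that AE_space by eventually_elim (rule term_fair)
  \<comment> \<open>On halting, consistency bounds the escape probability by the value of
    \<open>U\<close> at the initial state, which is below \<open>\<epsilon>\<close>.\<close>
  show "is_core M \<epsilon> (fst (c \<omega> n))" if "\<omega> \<in> space \<Omega>" "halted M \<epsilon> (c \<omega> n)" for \<omega> n
    using run_consistent[OF assms(1) assms(7)[OF that(1)] assms(5), of "init M" n] that(2)
    by (auto simp: is_core_def halted_def case_prod_beta)
qed

end
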